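(* For each integer $n\ge 3$, let $\mathcal{I}_n$ be the complete deterministic finite automaton with state set $\{1,2,\dots,n\}$ and two input letters $a,b$ acting by \[ i.a=\begin{cases} i &\text{if } i \text{ is odd or } i=n,\\ i+1 &\text{if } i \text{ is even and } i<n;\end{cases} \qquad i.b=\begin{cases} i &\text{if } i \text{ is even or } i=n,\\ i+1 &\text{if } i \text{ is odd and } i<n.\end{cases} \] Then the letters $a$ and $b$ act as idempotent selfmaps, the state $n$ is a unique sink of $\mathcal{I}_n$, $\mathcal{I}_n$ is synchronizing, and the reset threshold of $\mathcal{I}_n$ is at least $n-1$, since $n-1$ is the length of the shortest word that brings the state $1$ to the sink. The series $\mathcal{I}_n$, $n=3,4,\dots$, thus shows that the following upper bound is tight: the reset threshold of every synchronizing automaton with $n$ states and two idempotent input letters does not exceed $n-1$.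
   Context: A complete deterministic finite automaton (DFA) $\langle Q,\Sigma\rangle$ consists of a finite state set $Q$, a finite input alphabet $\Sigma$, and a totally defined transition function $Q\times\Sigma\to Q$, written $(q,a)\mapsto q.a$. It extends to words $w\in\Sigma^*$ (finite words, including the empty word) by $q.w:=q$ if $w$ is empty and $q.(va):=(q.v).a$ for $v\in\Sigma^*$, $a\in\Sigma$. A word $w\in\Sigma^*$ is a reset word for the DFA if $q.w=q'.w$ for all $q,q'\in Q$. The DFA is synchronizing if it has a reset word; its reset threshold is then the minimum length of its reset words. A letter $a\in\Sigma$ acts as an idempotent selfmap if $(q.a).a=q.a$ for every $q\in Q$. A state $s$ is a sink if $s.a=s$ for each input letter $a$. *)

theory Defs
  imports Main
begin

record ('q, 'x) dfa =
  states :: "'q set"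
  alphabet :: "'x set"
  trans :: "'q \<Rightarrow> 'x \<Rightarrow> 'q"

definition complete_dfa :: "('q, 'x) dfa \<Rightarrow> bool" where
  "complete_dfa A \<longleftrightarrow> finite (states A) \<and> finite (alphabet A) \<and>
     (\<forall>q\<in>states A. \<forall>x\<in>alphabet A. trans A q x \<in> states A)"

abbreviation words :: "('q, 'x) dfa \<Rightarrow> 'x list set" where
  "words A \<equiv> lists (alphabet A)"

definition act :: "('q, 'x) dfa \<Rightarrow> 'q \<Rightarrow> 'x list \<Rightarrow> 'q" where
  "act A q w = foldl (trans A) q w"

definition reset_word :: "('q, 'x) dfa \<Rightarrow> 'x list \<Rightarrow> bool" where
  "reset_word A w \<longleftrightarrow> w \<in> words A \<and>
     (\<forall>q\<in>states A. \<forall>q'\<in>states A. act A q w = act A q' w)"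

definition synchronizing :: "('q, 'x) dfa \<Rightarrow> bool" where
  "synchronizing A \<longleftrightarrow> (\<exists>w. reset_word A w)"

text \<open>Meaningful for synchronizing automata only; otherwise the value is unspecified.\<close>

definition reset_threshold :: "('q, 'x) dfa \<Rightarrow> nat" where
  "reset_threshold A = (LEAST k. \<exists>w. reset_word A w \<and> length w = k)"

definition idempotent_letter :: "('q, 'x) dfa \<Rightarrow> 'x \<Rightarrow> bool" where
  "idempotent_letter A x \<longleftrightarrow> (\<forall>q\<in>states A. trans A (trans A q x) x = trans A q x)"

definition sink :: "('q, 'x) dfa \<Rightarrow> 'q \<Rightarrow> bool" where
  "sink A s \<longleftrightarrow> s \<in> states A \<and> (\<forall>x\<in>alphabet A. trans A s x = s)"

text \<open>The two letters are distinct as letters; they may act in the same way.\<close>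

definition two_idempotent_letters :: "('q, 'x) dfa \<Rightarrow> bool" where
  "two_idempotent_letters A \<longleftrightarrow>
     card (alphabet A) = 2 \<and> (\<forall>x\<in>alphabet A. idempotent_letter A x)"

datatype letter = La | Lb

text \<open>Only the states in \<open>{1..n}\<close> matter; the transition function is total on \<open>nat\<close>.\<close>

fun I_trans :: "nat \<Rightarrow> nat \<Rightarrow> letter \<Rightarrow> nat" where
  "I_trans n i La = (if odd i \<or> i = n then i else i + 1)"
| "I_trans n i Lb = (if even i \<or> i = n then i else i + 1)"

definition I_dfa :: "nat \<Rightarrow> (nat, letter) dfa" where
  "I_dfa n = \<lparr>states = {1..n}, alphabet = {La, Lb}, trans = I_trans n\<rparr>"

end

(* Consecutive repetitions of an idempotent letter have no effect, so only alternating words matter.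
   Let g move a state by a letter that does not fix it, if there is one.  After a first letter x the
   automaton sits in the image of x, and the alternating word y x y ... acts there as iteration of g.
   If the automaton synchronizes, all g-trajectories end in one cycle {c, g c}.
   If c and g c are distinct, at most n - 2 steps lead into it, and parity decides where in the cycle
   one is.  If c is a sink and some trajectory from the image of x needs more than n - 2 steps, it
   runs through all states, so that no trajectory from the image of the other letter does. *)

theory Submission
  imports Defs
begin

section \<open>Reset words and alternating words\<close>

lemma act_Nil [simp]: "act A q [] = q"
  by (simp add: act_def)

lemma act_Cons [simp]: "act A q (z # w) = act A (trans A q z) w"
  by (simp add: act_def)

lemma reset_threshold_le: "reset_word A w \<Longrightarrow> reset_threshold A \<le> length w"
  unfolding reset_threshold_def by (rule Least_le) blast

lemma synchronizing_obtains_shortest: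
  assumes "synchronizing A"
  obtains w where "reset_word A w" "length w = reset_threshold A"
proof -
  from assms have "\<exists>k w. reset_word A w \<and> length w = k"
    by (auto simp: synchronizing_def)
  from LeastI_ex [OF this] show ?thesis
    using that unfolding reset_threshold_def by blast
qed

fun alternating :: "'x \<Rightarrow> 'x \<Rightarrow> nat \<Rightarrow> 'x list" where
  "alternating x y 0 = []"
| "alternating x y (Suc k) = x # alternating y x k"

lemma length_alternating [simp]: "length (alternating x y k) = k"
  by (induction k arbitrary: x y) auto

lemma alternating_in_lists: "{x, y} \<subseteq> S \<Longrightarrow> alternating x y k \<in> lists S"
  by (induction k arbitrary: x y) auto

subsection \<open>Iterating a map into an invariant set\<close>

lemma funpow_in: "(\<And>q. q \<in> S \<Longrightarrow> g q \<in> S) \<Longrightarrow> p \<in> S \<Longrightarrow> (g ^^ k) p \<in> S"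
  by (induction k) auto

lemma funpow_apply_funpow: "(g ^^ i) ((g ^^ j) p) = (g ^^ (i + j)) p"
  by (simp add: funpow_add)

text \<open>A repeated point would recur periodically, hence also after time \<open>K\<close>, when
  the trajectory is already in \<open>C\<close>. Invariance would then keep the trajectory in
  \<open>C\<close> up to time \<open>m\<close>.\<close>

lemma inj_on_trajectory:
  fixes g :: "'a \<Rightarrow> 'a"
  assumes inv: "\<And>q. q \<in> C \<Longrightarrow> g q \<in> C"
    and reach: "(g ^^ K) p \<in> C" and outside: "(g ^^ m) p \<notin> C"
  shows "inj_on (\<lambda>i. (g ^^ i) p) {..m}"
proof -
  have later: "(g ^^ j) p \<in> C" if "(g ^^ i) p \<in> C" "i \<le> j" for i j
    using funpow_in [of C g "(g ^^ i) p" "j - i"] inv that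
    by (simp add: funpow_apply_funpow)
  have False if "i < j" "j \<le> m" and eq: "(g ^^ i) p = (g ^^ j) p" for i j
  proof -
    define d where "d = j - i"
    have "d + i = j" using \<open>i < j\<close> by (simp add: d_def)
    then have period: "(g ^^ d) ((g ^^ i) p) = (g ^^ i) p"
      unfolding funpow_apply_funpow by (simp add: eq)
    have "(g ^^ (k * d + i)) p = (g ^^ i) p" for k
      by (induction k) (auto simp: funpow_add period add.assoc)
    \<comment> \<open>The period \<open>d\<close> is positive, so \<open>K\<close> periods suffice
      to pass time \<open>K\<close>.\<close>
    moreover have "K \<le> K * d + i"
      using \<open>i < j\<close> by (cases d) (auto simp: d_def)
    ultimately have "(g ^^ i) p \<in> C"
      using later [OF reach] by metis
    then show False
      using later [of i m] outside that by simp
  qed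
  then show ?thesis
    unfolding inj_on_def by (metis atMost_iff linorder_neqE_nat)
qed

lemma trajectory_outside:
  assumes S: "\<And>q. q \<in> S \<Longrightarrow> g q \<in> S" and inv: "\<And>q. q \<in> C \<Longrightarrow> g q \<in> C"
    and p: "p \<in> S" and outside: "(g ^^ m) p \<notin> C"
  shows "(\<lambda>i. (g ^^ i) p) ` {..m} \<subseteq> S - C"
proof clarify
  fix i assume "i \<le> m"
  then have "(g ^^ m) p = (g ^^ (m - i)) ((g ^^ i) p)"
    by (simp add: funpow_apply_funpow)
  then have "(g ^^ i) p \<notin> C"
    using funpow_in [of C g] inv outside by metis
  then show "(g ^^ i) p \<in> S - C"
    using funpow_in [of S g] S p by blast
qed

text \<open>Pigeonhole: otherwise the \<open>m + 1\<close> points at times \<open>0\<close> to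
  \<open>m\<close> are distinct and lie in \<open>S - C\<close>, which has at most \<open>m\<close>
  elements.\<close>

lemma trajectory_enters:
  assumes S: "finite S" "\<And>q. q \<in> S \<Longrightarrow> g q \<in> S" and inv: "\<And>q. q \<in> C \<Longrightarrow> g q \<in> C"
    and p: "p \<in> S" and reach: "(g ^^ K) p \<in> C" and m: "card (S - C) \<le> m"
  shows "(g ^^ m) p \<in> C"
proof (rule ccontr)
  assume outside: "(g ^^ m) p \<notin> C"
  have "card {..m} \<le> card (S - C)"
    using inj_on_trajectory [of C g, OF inv reach outside]
      trajectory_outside [of S g C, OF S(2) inv p outside] S(1)
    by (intro card_inj_on_le) auto
  with m show False by simp
qed

subsection \<open>Two idempotent letters\<close>

locale two_idempotents =
  fixes A :: "('q, 'x) dfa" and x y :: 'x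
  assumes finite_states: "finite (states A)"
    and alphabet: "alphabet A = {x, y}"
    and trans_closed [simp]: "z \<in> {x, y} \<Longrightarrow> q \<in> states A \<Longrightarrow> trans A q z \<in> states A"
    and idem [simp]: "z \<in> {x, y} \<Longrightarrow> q \<in> states A \<Longrightarrow>
          trans A (trans A q z) z = trans A q z"
begin

text \<open>For an idempotent letter this is its image, where the automaton sits after reading
  \<open>z\<close>.\<close>

definition fixed :: "'x \<Rightarrow> 'q set" where
  "fixed z = {q \<in> states A. trans A q z = q}"

text \<open>The map \<open>g\<close> of the overview. By convention, a state moved by both letters
  follows \<open>x\<close>.\<close>

definition move :: "'q \<Rightarrow> 'q" where
  "move q = (if trans A q x = q then trans A q y else trans A q x)"

lemma move_closed: "q \<in> states A \<Longrightarrow> move q \<in> states A"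
  by (simp add: move_def)

lemma move_x: "q \<in> fixed x \<Longrightarrow> move q = trans A q y"
  by (simp add: move_def fixed_def)

lemma move_y: "q \<in> fixed y \<Longrightarrow> move q = trans A q x"
  by (auto simp: move_def fixed_def)

text \<open>Here \<open>move\<close> acts as \<open>y\<close>, whose image is
  \<open>fixed y\<close>. With its mirror image below, this makes trajectories alternate between the
  two sets, the source of the parity argument.\<close>

lemma move_fixed_x: "q \<in> fixed x \<Longrightarrow> move q \<in> fixed y"
  by (simp add: move_x) (simp add: fixed_def)

lemma move_fixed_y: "q \<in> fixed y \<Longrightarrow> move q \<in> fixed x"
  by (simp add: move_y) (simp add: fixed_def)

lemma move_fixed_both: "q \<in> fixed x \<Longrightarrow> q \<in> fixed y \<Longrightarrow> move q = q"
  by (simp add: move_def fixed_def)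

text \<open>The letters alternate in step with the sets: in \<open>fixed x\<close> the next letter
  is \<open>y\<close>, which leads to \<open>fixed y\<close>, where the next letter is
  \<open>x\<close>.\<close>

lemma act_alternating:
  shows "p \<in> fixed x \<Longrightarrow> act A p (alternating y x k) = (move ^^ k) p"
    and "p \<in> fixed y \<Longrightarrow> act A p (alternating x y k) = (move ^^ k) p"
proof (induction k arbitrary: p)
  case (Suc k)
  {
    case 1
    then show ?case
      using Suc(2) [OF move_fixed_x] by (simp add: move_x funpow_Suc_right del: funpow.simps)
  next
    case 2
    then show ?case
      using Suc(1) [OF move_fixed_y] by (simp add: move_y funpow_Suc_right del: funpow.simps)
  }
qed auto

lemma funpow_move_fixed:
  assumes "p \<in> fixed x"
  shows "(move ^^ k) p \<in> (if even k then fixed x else fixed y)"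
  using assms by (induction k) (auto simp: move_fixed_x move_fixed_y)

text \<open>Induction from the front: a prepended letter is absorbed by idempotence if the
  alternating word starts with it, and otherwise lengthens that word.\<close>

lemma act_eq_alternating:
  assumes "w \<in> lists {x, y}"
  shows "\<exists>k u v. {u, v} = {x, y} \<and> (\<forall>q\<in>states A. act A q w = act A q (alternating u v k))"
  using assms
proof (induction w)
  case Nil
  show ?case by (intro exI [of _ 0] exI [of _ x] exI [of _ y]) simp
next
  case (Cons z w)
  then obtain k u v where uv: "{u, v} = {x, y}"
    and w: "\<And>q. q \<in> states A \<Longrightarrow> act A q w = act A q (alternating u v k)"
    by auto
  have z: "z \<in> {x, y}" using Cons.hyps by simp
  show ?case
  proof (cases "z = u \<and> k > 0")
    case True
    then obtain l where "k = Suc l" by (auto simp: gr0_conv_Suc)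
    then have "act A q (z # w) = act A q (alternating u v k)" if "q \<in> states A" for q
      using True w z that by simp
    with uv show ?thesis by blast
  next
    case False
    \<comment> \<open>The old word must be alternating when read as starting with \<open>t\<close>.
      If \<open>z = u\<close>, it is empty and \<open>t = v\<close> works; otherwise
      \<open>z = v\<close> and \<open>t = u\<close>.\<close>
    have "\<exists>t. {z, t} = {x, y} \<and> alternating t z k = alternating u v k"
    proof (cases "z = u")
      case True
      then show ?thesis using False uv by (intro exI [of _ v]) auto
    next
      case False
      then show ?thesis using uv z by (intro exI [of _ u]) auto
    qed
    then obtain t where t: "{z, t} = {x, y}" "alternating t z k = alternating u v k" by blast
    have "act A q (z # w) = act A q (alternating z t (Suc k))" if "q \<in> states A" for q
      using w z that by (simp add: t(2))
    with t show ?thesis by blast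
  qed
qed

text \<open>The first letter sends all states into its fixed set; the remaining \<open>m\<close>
  letters act there as \<open>move ^^ m\<close>.\<close>

lemma reset_word_alternating:
  shows "(\<And>p. p \<in> fixed x \<Longrightarrow> (move ^^ m) p = c) \<Longrightarrow> reset_word A (alternating x y (Suc m))"
    and "(\<And>p. p \<in> fixed y \<Longrightarrow> (move ^^ m) p = c) \<Longrightarrow> reset_word A (alternating y x (Suc m))"
proof -
  have words: "alternating x y (Suc m) \<in> words A" "alternating y x (Suc m) \<in> words A"
    using alphabet by (auto intro!: alternating_in_lists simp del: alternating.simps)
  have first: "trans A q x \<in> fixed x" "trans A q y \<in> fixed y" if "q \<in> states A" for q
    using that by (simp_all add: fixed_def)
  show "reset_word A (alternating x y (Suc m))" if "\<And>p. p \<in> fixed x \<Longrightarrow> (move ^^ m) p = c"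
    using words(1) by (simp add: reset_word_def act_alternating first that)
  show "reset_word A (alternating y x (Suc m))" if "\<And>p. p \<in> fixed y \<Longrightarrow> (move ^^ m) p = c"
    using words(2) by (simp add: reset_word_def act_alternating first that)
qed

text \<open>A reset word acts as an alternating word, and on the fixed set of the letter other than
  its leading one that word acts as a power of \<open>move\<close>.\<close>

lemma eventually_constant:
  assumes "synchronizing A"
  obtains k e where "(\<forall>p\<in>fixed x. (move ^^ k) p = e) \<or> (\<forall>p\<in>fixed y. (move ^^ k) p = e)"
proof -
  from assms obtain w where w: "w \<in> lists {x, y}"
    and const: "\<And>q q'. q \<in> states A \<Longrightarrow> q' \<in> states A \<Longrightarrow> act A q w = act A q' w"
    by (auto simp: synchronizing_def reset_word_def alphabet)
  obtain e where e: "\<And>q. q \<in> states A \<Longrightarrow> act A q w = e"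
    using const by blast
  obtain k u v where uv: "{u, v} = {x, y}"
    and alt: "\<And>q. q \<in> states A \<Longrightarrow> act A q w = act A q (alternating u v k)"
    using act_eq_alternating [OF w] by blast
  have const: "act A q (alternating u v k) = e" if "q \<in> states A" for q
    using e alt that by simp
  consider "u = x" "v = y" | "u = y" "v = x"
    using uv by (auto simp: doubleton_eq_iff)
  then show ?thesis
  proof cases
    case 1
    then have "\<forall>p\<in>fixed y. (move ^^ k) p = e"
      using const act_alternating(2) [of _ k] by (auto simp: fixed_def)
    then show ?thesis by (blast intro: that)
  next
    case 2
    then have "\<forall>p\<in>fixed x. (move ^^ k) p = e"
      using const act_alternating(1) [of _ k] by (auto simp: fixed_def)
    then show ?thesis by (blast intro: that)
  qed
qed

text \<open>Let \<open>e\<close> be the constant value of \<open>move ^^ k\<close> on one of the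
  fixed sets. Two moves lead back into that set, so \<open>move ^^ k\<close> still gives
  \<open>e\<close> after them, and commuting powers yields \<open>move (move e) = e\<close>. From
  the other set one extra move suffices.\<close>

lemma cycle_exists:
  assumes "synchronizing A" "states A \<noteq> {}"
  obtains c where "c \<in> fixed x" "move (move c) = c"
    "\<And>p. p \<in> fixed x \<union> fixed y \<Longrightarrow> \<exists>K. (move ^^ K) p \<in> {c, move c}"
proof -
  obtain k e where ke:
    "(\<forall>p\<in>fixed x. (move ^^ k) p = e) \<or> (\<forall>p\<in>fixed y. (move ^^ k) p = e)"
    using eventually_constant [OF assms(1)] .
  then obtain S T where S: "S = fixed x \<and> T = fixed y \<or> S = fixed y \<and> T = fixed x"
    and const: "\<And>p. p \<in> S \<Longrightarrow> (move ^^ k) p = e" by metis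
  have ST: "move p \<in> T" if "p \<in> S" for p
    using S that move_fixed_x move_fixed_y by blast
  have TS: "move p \<in> S" if "p \<in> T" for p
    using S that move_fixed_x move_fixed_y by blast
  obtain q where "q \<in> states A" using assms(2) by blast
  then have "trans A q x \<in> fixed x" by (simp add: fixed_def)
  then obtain p where p: "p \<in> S"
    using S move_fixed_x by blast
  have "(move ^^ k) (move (move p)) = e"
    using p ST TS const by blast
  then have "move (move ((move ^^ k) p)) = e"
    by (simp add: funpow_swap1)
  with p have cycle: "move (move e) = e"
    by (simp add: const)
  have "(move ^^ k) p \<in> S \<union> T"
    using p by (intro funpow_in) (auto simp: ST TS)
  then have e: "e \<in> fixed x \<union> fixed y"
    using const p S by blast
  have reach: "\<exists>K. (move ^^ K) p \<in> {e, move e}" if "p \<in> fixed x \<union> fixed y" for p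
  proof (cases "p \<in> S")
    case True
    then show ?thesis using const by blast
  next
    case False
    then have "move p \<in> S" using that S TS by blast
    then have "(move ^^ Suc k) p = e"
      using const by (simp add: funpow_Suc_right del: funpow.simps)
    then show ?thesis by blast
  qed
  show ?thesis
  proof (cases "e \<in> fixed x")
    case True
    then show ?thesis using that cycle reach by blast
  next
    case False
    \<comment> \<open>The cycle is the same pair of states when started at \<open>move e\<close>,
      which lies in the required set.\<close>
    then have "move e \<in> fixed x" using e move_fixed_y by blast
    then show ?thesis using that [of "move e"] cycle reach by (simp add: insert_commute)
  qed
qed

section \<open>The upper bound on the reset threshold\<close>

lemma reset_threshold_bound:
  assumes sync: "synchronizing A"
  shows "reset_threshold A \<le> card (states A) - 1"
proof (cases "card (states A) \<le> 1")
  case True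
  then have "reset_word A []"
    using finite_states by (auto simp: reset_word_def card_le_Suc0_iff_eq)
  then show ?thesis using reset_threshold_le by fastforce
next
  case False
  \<comment> \<open>A word of length \<open>card (states A) - 1\<close> leaves \<open>m\<close>
    moves after its first letter. There are at least two states here, so the subtraction is
    exact.\<close>
  define m where "m = card (states A) - 2"
  have m: "card (states A) = Suc (Suc m)" using False by (simp add: m_def)
  have "states A \<noteq> {}" using m by auto
  then obtain c where c: "c \<in> fixed x" and cycle: "move (move c) = c"
    and reach: "\<And>p. p \<in> fixed x \<union> fixed y \<Longrightarrow> \<exists>K. (move ^^ K) p \<in> {c, move c}"
    using cycle_exists [OF sync] by blast
  have states: "fixed x \<union> fixed y \<subseteq> states A" by (auto simp: fixed_def)
  have c_states: "c \<in> states A" "move c \<in> states A"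
    using c states move_closed by auto
  have inv: "move q \<in> {c, move c}" if "q \<in> {c, move c}" for q
    using that cycle by auto
  have "(\<exists>e. \<forall>p\<in>fixed x. (move ^^ m) p = e) \<or> (\<exists>e. \<forall>p\<in>fixed y. (move ^^ m) p = e)"
  proof (cases "move c = c")
    \<comment> \<open>Only \<open>m\<close> states lie off a two-point cycle, so \<open>m\<close>
      moves lead into it. Each cycle point lies in just one fixed set, so the parity of
      \<open>m\<close> selects the point.\<close>
    case False
    then have "c \<notin> fixed y" "move c \<notin> fixed x"
      using c cycle move_fixed_both move_fixed_x by metis+
    moreover have "(move ^^ m) p \<in> {c, move c}" if p: "p \<in> fixed x" for p
    proof -
      have "card (states A - {c, move c}) \<le> m"
        using m c_states False by (simp add: card_Diff_subset)
      moreover obtain K where "(move ^^ K) p \<in> {c, move c}" using reach p by blast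
      ultimately show ?thesis
        using trajectory_enters [of "states A" move "{c, move c}" p K m]
          finite_states move_closed inv p states by blast
    qed
    ultimately have "(move ^^ m) p = (if even m then c else move c)" if "p \<in> fixed x" for p
      using funpow_move_fixed [OF that, of m] \<open>p \<in> fixed x\<close> by (metis empty_iff insert_iff)
    then show ?thesis by blast
  next
    case sink: True
    show ?thesis
    proof (rule ccontr)
      assume "\<not> ?thesis"
      then obtain p q where p: "p \<in> fixed x" "(move ^^ m) p \<noteq> c"
        and q: "q \<in> fixed y" "(move ^^ m) q \<noteq> c" by blast
      have closed: "move r \<in> {c}" if "r \<in> {c}" for r using that sink by simp
      obtain K where K: "(move ^^ K) p \<in> {c}" using reach p sink by auto
      have "inj_on (\<lambda>i. (move ^^ i) p) {..m}"
        using inj_on_trajectory [OF closed K] p by blast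
      then have "card ((\<lambda>i. (move ^^ i) p) ` {..m}) = Suc m"
        by (simp add: card_image)
      moreover have "(\<lambda>i. (move ^^ i) p) ` {..m} \<subseteq> states A - {c}"
        using trajectory_outside [of "states A" move "{c}" p m] closed move_closed p states by blast
      \<comment> \<open>The \<open>m + 1\<close> distinct points must fill the \<open>m + 1\<close>
        states other than \<open>c\<close>.\<close>
      ultimately have all: "(\<lambda>i. (move ^^ i) p) ` {..m} = states A - {c}"
        using m c_states finite_states by (intro card_subset_eq) auto
      have fix_c: "(move ^^ i) c = c" for i
        by (induction i) (auto simp: sink)
      have "card (states A - {c}) \<le> Suc m"
        using m c_states by simp
      then have at_c: "(move ^^ Suc m) p = c"
        using trajectory_enters [of "states A" move "{c}" p K "Suc m"]
          finite_states move_closed closed p K states by blast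
      have "q \<in> states A - {c}" using q states fix_c by auto
      \<comment> \<open>So \<open>q\<close> lies on the trajectory of \<open>p\<close>. At time
        \<open>0\<close> it would equal \<open>p\<close>, making \<open>p\<close> fixed by both
        letters and unable to reach \<open>c\<close>. At a later time it is ahead of
        \<open>p\<close> by at least one move, so \<open>m\<close> moves bring it to
        \<open>c\<close>.\<close>
      with all obtain i where i: "q = (move ^^ i) p" by blast
      show False
      proof (cases i)
        case 0
        then have "move p = p" using i p q move_fixed_both by simp
        then have "(move ^^ j) p = p" for j by (induction j) auto
        then show False using p K by simp
      next
        case (Suc j)
        have "(move ^^ m) q = (move ^^ (m + Suc j)) p"
          unfolding funpow_add by (simp add: i Suc)
        also have "\<dots> = (move ^^ (j + Suc m)) p"
          by (simp add: add.commute)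
        also have "\<dots> = c"
          unfolding funpow_add comp_apply at_c by (rule fix_c)
        finally show False using q by blast
      qed
    qed
  qed
  then obtain w where "reset_word A w" "length w = Suc m"
    using reset_word_alternating by (metis length_alternating)
  then show ?thesis
    using reset_threshold_le [of A w] m by simp
qed

end

theorem reset_threshold_two_idempotent_letters:
  assumes "complete_dfa A" "two_idempotent_letters A" "synchronizing A"
  shows "reset_threshold A \<le> card (states A) - 1"
proof -
  obtain x y where "alphabet A = {x, y}"
    using assms(2) by (auto simp: two_idempotent_letters_def card_2_iff)
  then have "two_idempotents A x y"
    using assms(1,2)
    by unfold_locales (auto simp: complete_dfa_def two_idempotent_letters_def idempotent_letter_def)
  then show ?thesis
    using assms(3) by (rule two_idempotents.reset_threshold_bound)
qed

subsection \<open>The automata attaining the bound\<close>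

lemma I_dfa_simps [simp]:
  "states (I_dfa n) = {1..n}" "alphabet (I_dfa n) = {La, Lb}" "trans (I_dfa n) = I_trans n"
  by (simp_all add: I_dfa_def)

lemma complete_I_dfa: "complete_dfa (I_dfa n)"
  by (auto simp: complete_dfa_def)

lemma idempotent_I_dfa: "idempotent_letter (I_dfa n) z"
  by (cases z) (auto simp: idempotent_letter_def)

lemma two_idempotent_letters_I_dfa: "two_idempotent_letters (I_dfa n)"
  by (simp add: two_idempotent_letters_def idempotent_I_dfa)

text \<open>Below \<open>n\<close>, \<open>La\<close> moves the even states and \<open>Lb\<close>
  the odd ones.\<close>

lemma sink_I_dfa: "n \<ge> 1 \<Longrightarrow> sink (I_dfa n) s \<longleftrightarrow> s = n"
  by (auto simp: sink_def split: if_splits)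

section \<open>Action of words on the automata \<open>I_dfa n\<close>\<close>

lemma act_I_dfa_le: "act (I_dfa n) i w \<le> i + length w"
proof (induction w arbitrary: i)
  case (Cons z w)
  have "I_trans n i z \<le> Suc i" by (cases z) auto
  with Cons [of "I_trans n i z"] show ?case by simp
qed simp

lemma act_I_dfa_range: "i \<le> n \<Longrightarrow> act (I_dfa n) i w \<le> n"
proof (induction w arbitrary: i)
  case (Cons z w)
  then have "I_trans n i z \<le> n" by (cases z) auto
  with Cons show ?case by simp
qed simp

text \<open>If \<open>i < j\<close>, a letter sends \<open>i\<close> to at most
  \<open>i + 1 \<le> j\<close> and never lowers \<open>j\<close>. Thus a word taking
  \<open>1\<close> to \<open>n\<close> takes every state to \<open>n\<close>.\<close>

lemma act_I_dfa_mono: "i \<le> j \<Longrightarrow> j \<le> n \<Longrightarrow> act (I_dfa n) i w \<le> act (I_dfa n) j w"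
proof (induction w arbitrary: i j)
  case (Cons z w)
  then have "I_trans n i z \<le> I_trans n j z" "I_trans n j z \<le> n"
    by (cases z; cases "i = j"; force)+
  with Cons show ?case by simp
qed simp

text \<open>The parity of a state below \<open>n\<close> determines the letter that advances it, and
  each advance flips the parity.\<close>

lemma act_I_dfa_alternating:
  "i + k = n \<Longrightarrow> act (I_dfa n) i (if odd i then alternating Lb La k else alternating La Lb k) = n"
proof (induction k arbitrary: i)
  case (Suc k)
  then show ?case using Suc.IH [of "Suc i"] by (auto split: if_splits)
qed auto

lemma act_I_dfa_1:
  assumes "n \<ge> 1"
  shows "act (I_dfa n) 1 (alternating Lb La (n - 1)) = n"
  using act_I_dfa_alternating [of 1 "n - 1" n] assms by simp

section \<open>Shortest words to the sink and the reset threshold of \<open>I_dfa n\<close>\<close>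

lemma length_to_sink: "act (I_dfa n) 1 w = n \<Longrightarrow> n - 1 \<le> length w"
  using act_I_dfa_le [of n 1 w] by simp

lemma alternating_words: "alternating Lb La k \<in> words (I_dfa n)"
  using alternating_in_lists [of Lb La "{La, Lb}" k] by simp

lemma synchronizing_I_dfa:
  assumes "n \<ge> 1"
  shows "synchronizing (I_dfa n)"
proof -
  let ?w = "alternating Lb La (n - 1)"
  \<comment> \<open>The image of \<open>i\<close> is squeezed between the image of \<open>1\<close>,
    which is \<open>n\<close>, and the largest state \<open>n\<close>.\<close>
  have "act (I_dfa n) i ?w = n" if "i \<in> {1..n}" for i
    using act_I_dfa_mono [of 1 i n ?w] act_I_dfa_range [of i n ?w] act_I_dfa_1 [OF assms] that
    by simp
  then have "reset_word (I_dfa n) ?w"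
    using alternating_words by (simp add: reset_word_def)
  then show ?thesis by (auto simp: synchronizing_def)
qed

text \<open>Every word fixes the sink \<open>n\<close>, so a reset word must bring \<open>1\<close>
  to \<open>n\<close>; as each letter advances a state by at most one, this takes
  \<open>n - 1\<close> letters.\<close>

lemma reset_threshold_I_dfa_ge:
  assumes "n \<ge> 1"
  shows "n - 1 \<le> reset_threshold (I_dfa n)"
proof -
  obtain w where w: "reset_word (I_dfa n) w" "length w = reset_threshold (I_dfa n)"
    using synchronizing_obtains_shortest [OF synchronizing_I_dfa [OF assms]] .
  have "I_trans n n z = n" for z by (cases z) auto
  then have "act (I_dfa n) n w = n" by (induction w) auto
  moreover have "act (I_dfa n) 1 w = act (I_dfa n) n w"
    using w(1) assms unfolding reset_word_def by (simp del: One_nat_def)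
  ultimately have "act (I_dfa n) 1 w = n" by simp
  with w show ?thesis using length_to_sink by metis
qed

lemma reset_threshold_I_dfa: "n \<ge> 1 \<Longrightarrow> reset_threshold (I_dfa n) = n - 1"
  using reset_threshold_I_dfa_ge [of n] synchronizing_I_dfa [of n]
    reset_threshold_two_idempotent_letters [OF complete_I_dfa two_idempotent_letters_I_dfa, of n]
  by simp

theorem mainTheorem5:
  shows
    "(\<forall>n\<ge>3.
        complete_dfa (I_dfa n) \<and>
        idempotent_letter (I_dfa n) La \<and> idempotent_letter (I_dfa n) Lb \<and>
        (\<forall>s. sink (I_dfa n) s \<longleftrightarrow> s = n) \<and>
        synchronizing (I_dfa n) \<and>
        (\<exists>w\<in>words (I_dfa n). act (I_dfa n) 1 w = n \<and> length w = n - 1) \<and>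
        (\<forall>w\<in>words (I_dfa n). act (I_dfa n) 1 w = n \<longrightarrow> n - 1 \<le> length w) \<and>
        n - 1 \<le> reset_threshold (I_dfa n)) \<and>
     (\<forall>n\<ge>1. \<forall>A :: ('q, 'x) dfa.
        complete_dfa A \<and> card (states A) = n \<and> two_idempotent_letters A \<and> synchronizing A
        \<longrightarrow> reset_threshold A \<le> n - 1) \<and>
     (\<forall>n\<ge>3.
        card (states (I_dfa n)) = n \<and> two_idempotent_letters (I_dfa n) \<and>
        synchronizing (I_dfa n) \<and> reset_threshold (I_dfa n) = n - 1)"
proof (intro conjI allI impI)
  fix n :: nat assume "3 \<le> n"
  then have n: "n \<ge> 1" by simp
  show "complete_dfa (I_dfa n)" by (rule complete_I_dfa)
  show "idempotent_letter (I_dfa n) La" "idempotent_letter (I_dfa n) Lb"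
    by (rule idempotent_I_dfa)+
  show "sink (I_dfa n) s \<longleftrightarrow> s = n" for s by (rule sink_I_dfa [OF n])
  show "synchronizing (I_dfa n)" by (rule synchronizing_I_dfa [OF n])
  show "\<exists>w\<in>words (I_dfa n). act (I_dfa n) 1 w = n \<and> length w = n - 1"
    using act_I_dfa_1 [OF n] by (intro bexI [OF _ alternating_words]) simp
  show "\<forall>w\<in>words (I_dfa n). act (I_dfa n) 1 w = n \<longrightarrow> n - 1 \<le> length w"
    using length_to_sink by blast
  show "n - 1 \<le> reset_threshold (I_dfa n)" by (rule reset_threshold_I_dfa_ge [OF n])
next
  fix n :: nat and A :: "('q, 'x) dfa"
  assume "complete_dfa A \<and> card (states A) = n \<and> two_idempotent_letters A \<and> synchronizing A"
  then show "reset_threshold A \<le> n - 1"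
    using reset_threshold_two_idempotent_letters by blast
next
  fix n :: nat assume "3 \<le> n"
  then have n: "n \<ge> 1" by simp
  show "card (states (I_dfa n)) = n" by simp
  show "two_idempotent_letters (I_dfa n)" by (rule two_idempotent_letters_I_dfa)
  show "synchronizing (I_dfa n)" by (rule synchronizing_I_dfa [OF n])
  show "reset_threshold (I_dfa n) = n - 1" by (rule reset_threshold_I_dfa [OF n])
qed

end
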